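(* Let $\Gamma$ be any 4-ary construction in which every vertex is assigned an eight-vertex constraint function whose parameter tuple $(a,b,c,d)$ lies in $\overline{\mathcal{F}_>}$. Then the constraint function $f$ defined by $\Gamma$ is again an eight-vertex constraint function, and its parameter tuple $(a',b',c',d')$ also lies in $\overline{\mathcal{F}_>}$. That is, the set of eight-vertex constraint functions with parameters in $\overline{\mathcal{F}_>}$ is closed under 4-ary constructions.
   Context: An eight-vertex constraint function with parameters $(a,b,c,d)\in\mathbb{R}_{\ge 0}^4$ is the function $f:\{0,1\}^4\to\mathbb{R}_{\ge0}$ given by $f(0011)=f(1100)=a$, $f(0110)=f(1001)=b$, $f(0101)=f(1010)=c$, $f(0000)=f(1111)=d$, and $f(x)=0$ whenever $x$ has an odd number of ones. It is placed at a vertex whose four incident edge-ends are labeled $e_1,e_2,e_3,e_4$; given an orientation of the edges, the $i$-th input bit is $0$ if $e_i$ points into the vertex and $1$ if it points out. Define $\overline{\mathcal{F}_>}$ as the set of $(a,b,c,d)\in\mathbb{R}_{\ge0}^4$ satisfying $a\le b+c+d$, $b\le a+c+d$, $c\le a+b+d$ and $d\le a+b+c$ (i.e. no parameter exceeds the sum of the other three). A 4-ary construction is a finite graph $\Gamma$ (multiple edges and loops allowed) together with four dangling edges $e_1,e_2,e_3,e_4$, each attached at one end to a vertex of $\Gamma$, such that every vertex has degree exactly $4$ (counting dangling edges and counting loops twice); at each vertex the four incident edge-ends are labeled $1,2,3,4$ and a constraint function is assigned. The constraint function $f$ defined by $\Gamma$ is the function on $\{0,1\}^4$ with $f(b_1b_2b_3b_4)=\sum_\sigma\prod_{v}f_v(\sigma|_v)$,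 the sum over all orientations $\sigma$ of the internal edges of $\Gamma$, where each dangling edge $e_i$ is oriented into $\Gamma$ if $b_i=0$ and out of $\Gamma$ if $b_i=1$, and $f_v(\sigma|_v)$ is the constraint function at $v$ evaluated on the induced local orientation. *)

theory Defs
  imports Complex_Main "HOL-Library.FuncSet" "HOL-Library.Z2"
begin

type_synonym constraint = "bit \<Rightarrow> bit \<Rightarrow> bit \<Rightarrow> bit \<Rightarrow> real"

definition eight_vertex :: "real \<times> real \<times> real \<times> real \<Rightarrow> constraint" where
  "eight_vertex = (\<lambda>(a, b, c, d) x1 x2 x3 x4.
     if [x1, x2, x3, x4] \<in> {[0,0,1,1], [1,1,0,0]} then a
     else if [x1, x2, x3, x4] \<in> {[0,1,1,0], [1,0,0,1]} then b
     else if [x1, x2, x3, x4] \<in> {[0,1,0,1], [1,0,1,0]} then c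
     else if [x1, x2, x3, x4] \<in> {[0,0,0,0], [1,1,1,1]} then d
     else 0)"

lemma eight_vertex_odd:
  "x1 + x2 + x3 + x4 = 1 \<Longrightarrow> eight_vertex p x1 x2 x3 x4 = 0"
  by (cases x1; cases x2; cases x3; cases x4) (auto simp: eight_vertex_def split: prod.splits)

definition F_gt_closure :: "(real \<times> real \<times> real \<times> real) set" where
  "F_gt_closure = {(a, b, c, d).
     0 \<le> a \<and> 0 \<le> b \<and> 0 \<le> c \<and> 0 \<le> d \<and>
     a \<le> b + c + d \<and> b \<le> a + c + d \<and> c \<le> a + b + d \<and> d \<le> a + b + c}"

text \<open>
  An internal edge \<open>e\<close> has the two ends \<open>Inner e False\<close> and \<open>Inner e True\<close>, which may lie at the
  same vertex (a loop). A dangling edge has only one end, so it is identified with that end.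
\<close>

datatype 'e edge_end = Inner 'e bool | Dangling nat

record ('v, 'e) construction =
  verts :: "'v set"
  edges :: "'e set"
  end_vertex :: "'e edge_end \<Rightarrow> 'v"
  end_label :: "'e edge_end \<Rightarrow> nat"
  vertex_fun :: "'v \<Rightarrow> constraint"

definition edge_ends :: "('v, 'e, 'm) construction_scheme \<Rightarrow> 'e edge_end set" where
  "edge_ends \<Gamma> = {Inner e s | e s. e \<in> edges \<Gamma>} \<union> Dangling ` {1..4}"

definition ends_at :: "('v, 'e, 'm) construction_scheme \<Rightarrow> 'v \<Rightarrow> 'e edge_end set" where
  "ends_at \<Gamma> v = {h \<in> edge_ends \<Gamma>. end_vertex \<Gamma> h = v}"

definition four_ary_construction :: "('v, 'e, 'm) construction_scheme \<Rightarrow> bool" where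
  "four_ary_construction \<Gamma> \<longleftrightarrow>
     finite (verts \<Gamma>) \<and> finite (edges \<Gamma>) \<and>
     (\<forall>h \<in> edge_ends \<Gamma>. end_vertex \<Gamma> h \<in> verts \<Gamma>) \<and>
     (\<forall>v \<in> verts \<Gamma>. card (ends_at \<Gamma> v) = 4 \<and> bij_betw (end_label \<Gamma>) (ends_at \<Gamma> v) {1..4})"

text \<open>
  An orientation \<open>\<sigma>\<close> of the internal edges makes \<open>Inner e (\<sigma> e)\<close> the head of \<open>e\<close>. An end carries
  the bit 0 if its edge points into the vertex there, and 1 if it points out of that vertex. A
  dangling edge pointing into the graph points into the vertex it is attached to.
\<close>

definition end_bit :: "(nat \<Rightarrow> bit) \<Rightarrow> ('e \<Rightarrow> bool) \<Rightarrow> 'e edge_end \<Rightarrow> bit" where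
  "end_bit \<beta> \<sigma> h = (case h of
      Inner e s \<Rightarrow> (if \<sigma> e = s then 0 else 1)
    | Dangling i \<Rightarrow> \<beta> i)"

definition local_bit ::
  "('v, 'e, 'm) construction_scheme \<Rightarrow> (nat \<Rightarrow> bit) \<Rightarrow> ('e \<Rightarrow> bool) \<Rightarrow> 'v \<Rightarrow> nat \<Rightarrow> bit" where
  "local_bit \<Gamma> \<beta> \<sigma> v i = end_bit \<beta> \<sigma> (THE h. h \<in> ends_at \<Gamma> v \<and> end_label \<Gamma> h = i)"

definition construction_fun :: "('v, 'e, 'm) construction_scheme \<Rightarrow> constraint" where
  "construction_fun \<Gamma> b1 b2 b3 b4 =
     (let \<beta> = (\<lambda>i. [b1, b2, b3, b4] ! (i - 1)) in
      \<Sum>\<sigma> \<in> edges \<Gamma> \<rightarrow>\<^sub>E UNIV. \<Prod>v \<in> verts \<Gamma>.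
        vertex_fun \<Gamma> v (local_bit \<Gamma> \<beta> \<sigma> v 1) (local_bit \<Gamma> \<beta> \<sigma> v 2)
                       (local_bit \<Gamma> \<beta> \<sigma> v 3) (local_bit \<Gamma> \<beta> \<sigma> v 4))"

end

(* The tuples in the closure form the cone spanned by the six sums of two unit vectors, that is, by
   the constraint functions x_i + x_j = s, x_k + x_l = s (mod 2), one for each pairing ij|kl and sign s.
   By multilinearity every vertex may carry such a pairing. The edge-ends are then linked
   up into circuits and two paths between dangling edges, so the constructed function is a
   nonnegative multiple of the indicator of x_i + x_j = s, x_k + x_l = s'. As the number of internal
   edges is even, this function vanishes on odd inputs, and so it is zero unless s = s'. *)

theory Submission
  imports Defs
begin

section \<open>Signed matchings\<close>

text \<open>A perfect matching of \<open>H\<close> is encoded as a fixed-point-free involution; the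
  sign of a pair is stored at both of its points, so no representative has to be chosen.\<close>

definition signed_matching :: "'h set \<Rightarrow> ('h \<Rightarrow> 'h) \<Rightarrow> ('h \<Rightarrow> bit) \<Rightarrow> bool" where
  "signed_matching H n s \<longleftrightarrow> (\<forall>h\<in>H. n h \<in> H \<and> n h \<noteq> h \<and> n (n h) = h \<and> s (n h) = s h)"

definition satisfies :: "'h set \<Rightarrow> ('h \<Rightarrow> 'h) \<Rightarrow> ('h \<Rightarrow> bit) \<Rightarrow> ('h \<Rightarrow> bit) \<Rightarrow> bool" where
  "satisfies H n s x \<longleftrightarrow> (\<forall>h\<in>H. x h + x (n h) = s h)"

lemma UNIV_bit: "(UNIV :: bit set) = {0, 1}"
  using bit.exhaust by auto

text \<open>Here \<open>u\<close> and \<open>w\<close> are the ends of one edge, so they carry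
  opposite bits. If they are partners, the edge closes a circuit, which yields a constant. Otherwise
  it splices their two pairs into a single pair formed by the former partners.\<close>

lemma contract_pair:
  fixes n :: "'h \<Rightarrow> 'h"
  assumes M: "signed_matching (insert u (insert w H)) n s"
    and uw: "u \<noteq> w" "u \<notin> H" "w \<notin> H"
  shows "\<exists>C n' s'. C \<ge> (0::real) \<and> signed_matching H n' s' \<and>
    (\<forall>x. (\<Sum>z\<in>UNIV. of_bool (satisfies (insert u (insert w H)) n s (x(u := z, w := z + 1))))
       = C * of_bool (satisfies H n' s' x))"
proof (cases "n u = w")
  case True
  have nw: "n w = u" using M True by (auto simp: signed_matching_def)
  have nH: "n h \<in> H" if "h \<in> H" for h
    using M that True nw uw unfolding signed_matching_def by (metis insert_iff)
  have "signed_matching H n s" using M nH by (auto simp: signed_matching_def)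
  moreover have "satisfies (insert u (insert w H)) n s (x(u := z, w := z + 1)) \<longleftrightarrow>
      s u = 1 \<and> satisfies H n s x" for x z
  proof -
    have "s w = s u" using M True by (auto simp: signed_matching_def)
    moreover have "h \<noteq> u \<and> h \<noteq> w \<and> n h \<noteq> u \<and> n h \<noteq> w" if "h \<in> H" for h
      using that nH[OF that] uw by auto
    ultimately show ?thesis
      using uw nw True by (cases z; cases "s u") (auto simp: satisfies_def)
  qed
  \<comment> \<open>The closed circuit demands \<open>z + (z + 1) = s u\<close>, that is
    \<open>s u = 1\<close>, whatever \<open>z\<close> is; so both values of \<open>z\<close> count
    or neither does.\<close>
  ultimately show ?thesis
    by (intro exI[of _ "2 * of_bool (s u = 1)"] exI[of _ n] exI[of _ s])
       (auto simp: UNIV_bit)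
next
  case False
  define p q where "p = n u" and "q = n w"
  have p: "p \<in> H" "n p = u" "s p = s u"
    using M False uw by (auto simp: signed_matching_def p_def)
  have q: "q \<in> H" "n q = w" "s q = s w"
    using M False uw by (auto simp: signed_matching_def q_def)
  have pq: "p \<noteq> q" using p q uw by metis
  define n' where "n' = n(p := q, q := p)"
  \<comment> \<open>Adding \<open>z + x p = s u\<close> and \<open>z + 1 + x q = s w\<close>
    eliminates \<open>z\<close> and leaves this sign.\<close>
  define s' where "s' = s(p := s u + s w + 1, q := s u + s w + 1)"
  have rest: "n h \<in> H \<and> n h \<noteq> p \<and> n h \<noteq> q" if "h \<in> H" "h \<noteq> p" "h \<noteq> q" for h
    using M that uw unfolding signed_matching_def p_def q_def by (metis insert_iff)
  have "signed_matching H n' s'"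
    unfolding signed_matching_def
  proof
    fix h assume "h \<in> H"
    then show "n' h \<in> H \<and> n' h \<noteq> h \<and> n' (n' h) = h \<and> s' (n' h) = s' h"
      using p q pq rest[of h] M
      by (cases "h = p"; cases "h = q") (auto simp: n'_def s'_def signed_matching_def)
  qed
  \<comment> \<open>The constant is 1 because the first equation forces
    \<open>z = s u + x p\<close>.\<close>
  moreover have "(\<Sum>z\<in>UNIV. of_bool (satisfies (insert u (insert w H)) n s (x(u := z, w := z + 1))))
       = (1::real) * of_bool (satisfies H n' s' x)" for x
  proof -
    let ?R = "\<forall>h\<in>H - {p, q}. x h + x (n h) = s h"
    have ballH: "(\<forall>h\<in>H. P h) \<longleftrightarrow> P p \<and> P q \<and> (\<forall>h\<in>H - {p, q}. P h)" for P
      using p(1) q(1) by blast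
    have 1: "satisfies (insert u (insert w H)) n s (x(u := z, w := z + 1)) \<longleftrightarrow>
        z + x p = s u \<and> z + 1 + x q = s w \<and> ?R" for z
    proof -
      let ?y = "x(u := z, w := z + 1)"
      have y: "?y u = z" "?y w = z + 1" "?y p = x p" "?y q = x q"
        using p(1) q(1) uw by auto
      have yR: "(\<forall>h\<in>H - {p, q}. ?y h + ?y (n h) = s h) \<longleftrightarrow> ?R"
      proof (rule ball_cong[OF refl])
        fix h assume h: "h \<in> H - {p, q}"
        then have "n h \<in> H" using rest by blast
        with h uw have "h \<noteq> u" "h \<noteq> w" "n h \<noteq> u" "n h \<noteq> w" by auto
        then show "?y h + ?y (n h) = s h \<longleftrightarrow> x h + x (n h) = s h" by simp
      qed
      show ?thesis
        unfolding satisfies_def ball_simps(7) ballH p_def [symmetric] q_def [symmetric]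
          p(2,3) q(2,3) y yR add.commute[of "x p" z] add.commute[of "x q" "z + 1"]
        by blast
    qed
    have 2: "satisfies H n' s' x \<longleftrightarrow> x p + x q = s u + s w + 1 \<and> ?R"
    proof -
      have n'R: "(\<forall>h\<in>H - {p, q}. x h + x (n' h) = s' h) \<longleftrightarrow> ?R"
        by (rule ball_cong[OF refl]) (simp add: n'_def s'_def)
      have "n' p = q" "n' q = p" "s' p = s u + s w + 1" "s' q = s u + s w + 1"
        using pq by (auto simp: n'_def s'_def)
      then show ?thesis
        unfolding satisfies_def ballH n'R by (metis add.commute)
    qed
    show ?thesis
      unfolding 1 2 UNIV_bit
      by (cases "x p"; cases "x q"; cases "s u"; cases "s w") auto
  qed
  ultimately show ?thesis by (intro exI[of _ 1] exI[of _ n'] exI[of _ s']) auto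
qed

text \<open>Once the partner of the first point is known, the two remaining points can only be
  joined to each other.\<close>

lemma signed_matching_four:
  assumes "signed_matching (Dangling ` {1..4}) n s"
  obtains "n (Dangling 1) = Dangling 2" "n (Dangling 3) = Dangling 4"
  | "n (Dangling 1) = Dangling 3" "n (Dangling 2) = Dangling 4"
  | "n (Dangling 1) = Dangling 4" "n (Dangling 2) = Dangling 3"
proof -
  have "{1..4::nat} = {1, 2, 3, 4}" by auto
  then show ?thesis
    using assms that unfolding signed_matching_def by auto
qed

section \<open>Contracting the internal edges\<close>

text \<open>The edge-ends depend on the edge set alone; stating this separately permits induction on
  the edges without altering a construction.\<close>

definition ends_of :: "'e set \<Rightarrow> 'e edge_end set" where
  "ends_of E = {Inner e s | e s. e \<in> E} \<union> Dangling ` {1..4}"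

lemma ends_of_insert:
  "ends_of (insert e E) = insert (Inner e False) (insert (Inner e True) (ends_of E))"
  unfolding ends_of_def by auto

lemma ends_of_empty: "ends_of {} = Dangling ` {1..4}"
  by (auto simp: ends_of_def)

lemma finite_ends_of: "finite E \<Longrightarrow> finite (ends_of E)"
  by (induction E rule: finite_induct) (simp_all add: ends_of_insert ends_of_empty)

text \<open>Kept general in the monoid because it serves twice: in \<open>nat\<close> to count
  edge-ends, and in \<open>bit\<close> to add up their bits.\<close>

lemma sum_ends_of:
  fixes f :: "'e edge_end \<Rightarrow> 'a::comm_monoid_add"
  assumes "finite E"
  shows "sum f (ends_of E) =
    (\<Sum>e\<in>E. f (Inner e False) + f (Inner e True)) + (\<Sum>i\<in>{1..4}. f (Dangling i))"
  using assms
proof (induction E rule: finite_induct)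
  case empty
  show ?case by (simp add: ends_of_empty sum.reindex inj_on_def)
next
  case (insert e E)
  then have "Inner e b \<notin> ends_of E" for b by (auto simp: ends_of_def)
  with insert show ?case by (simp add: ends_of_insert finite_ends_of add_ac)
qed

lemma sum_PiE_insert:
  assumes "e \<notin> E"
  shows "(\<Sum>\<sigma>\<in>insert e E \<rightarrow>\<^sub>E (UNIV :: bool set). f \<sigma>)
    = (\<Sum>\<sigma>\<in>E \<rightarrow>\<^sub>E UNIV. \<Sum>b\<in>UNIV. f (\<sigma>(e := b)))"
proof -
  have "(\<Sum>\<sigma>\<in>insert e E \<rightarrow>\<^sub>E (UNIV :: bool set). f \<sigma>)
      = (\<Sum>(b, \<sigma>)\<in>UNIV \<times> (E \<rightarrow>\<^sub>E UNIV). f (\<sigma>(e := b)))"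
    using inj_combinator[OF assms, of "\<lambda>_. UNIV :: bool set"]
    by (simp add: PiE_insert_eq sum.reindex case_prod_unfold comp_def)
  also have "\<dots> = (\<Sum>b\<in>UNIV. \<Sum>\<sigma>\<in>E \<rightarrow>\<^sub>E UNIV. f (\<sigma>(e := b)))"
    by (simp add: sum.cartesian_product)
  also have "\<dots> = (\<Sum>\<sigma>\<in>E \<rightarrow>\<^sub>E UNIV. \<Sum>b\<in>UNIV. f (\<sigma>(e := b)))"
    by (rule sum.swap)
  finally show ?thesis .
qed

text \<open>The head \<open>Inner e b\<close> gets bit 0 and the other end bit 1. Written this way,
  the two ends have the form \<open>z\<close>, \<open>z + 1\<close> of
  \<open>contract_pair\<close>.\<close>

lemma end_bit_upd:
  "end_bit \<beta> (\<sigma>(e := b)) = (end_bit \<beta> \<sigma>)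
     (Inner e False := of_bool b, Inner e True := of_bool b + 1)"
  by (rule ext) (auto simp: end_bit_def split: edge_end.splits)

text \<open>Edges are contracted one at a time and the constants multiply; none of them depends on
  \<open>\<beta>\<close>. The orientation \<open>\<lambda>_. undefined\<close> is the only one left
  when no edge remains, and dangling ends ignore it.\<close>

lemma contract_edges:
  fixes E :: "'e set"
  assumes "finite E" "signed_matching (ends_of E) n s"
  shows "\<exists>K (m :: 'e edge_end \<Rightarrow> 'e edge_end) t. K \<ge> (0::real) \<and> signed_matching (Dangling ` {1..4}) m t \<and>
    (\<forall>\<beta>. (\<Sum>\<sigma>\<in>E \<rightarrow>\<^sub>E UNIV. of_bool (satisfies (ends_of E) n s (end_bit \<beta> \<sigma>)))
       = K * of_bool (satisfies (Dangling ` {1..4}) m t (end_bit \<beta> (\<lambda>_. undefined))))"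
  using assms
proof (induction E arbitrary: n s rule: finite_induct)
  case empty
  then show ?case
    by (intro exI[of _ 1] exI[of _ n] exI[of _ s]) (simp add: ends_of_empty del: sum_of_bool_eq)
next
  case (insert e E)
  have "Inner e b \<notin> ends_of E" for b using insert.hyps by (auto simp: ends_of_def)
  from contract_pair[OF insert.prems[unfolded ends_of_insert] _ this this]
  obtain C n' s' where C: "C \<ge> (0::real)" "signed_matching (ends_of E) n' s'"
    "\<And>x. (\<Sum>z\<in>UNIV. of_bool (satisfies (ends_of (insert e E)) n s
        (x(Inner e False := z, Inner e True := z + 1)))) = C * of_bool (satisfies (ends_of E) n' s' x)"
    by (auto simp: ends_of_insert)
  from insert.IH[OF C(2)] obtain K t and m :: "'e edge_end \<Rightarrow> 'e edge_end"
    where K: "K \<ge> (0::real)"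
    "signed_matching (Dangling ` {1..4}) m t"
    "\<And>\<beta>. (\<Sum>\<sigma>\<in>E \<rightarrow>\<^sub>E UNIV. of_bool (satisfies (ends_of E) n' s' (end_bit \<beta> \<sigma>)))
       = K * of_bool (satisfies (Dangling ` {1..4}) m t (end_bit \<beta> (\<lambda>_. undefined)))"
    by blast
  have "(\<Sum>\<sigma>\<in>insert e E \<rightarrow>\<^sub>E UNIV. of_bool (satisfies (ends_of (insert e E)) n s (end_bit \<beta> \<sigma>)))
       = C * K * of_bool (satisfies (Dangling ` {1..4}) m t (end_bit \<beta> (\<lambda>_. undefined)))" for \<beta>
  proof -
    \<comment> \<open>The two directions \<open>b\<close> of \<open>e\<close> correspond to the two
      values of the bit \<open>z\<close> at \<open>Inner e False\<close>.\<close>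
    have "(\<Sum>b\<in>UNIV. of_bool (satisfies (ends_of (insert e E)) n s (end_bit \<beta> (\<sigma>(e := b)))))
        = C * of_bool (satisfies (ends_of E) n' s' (end_bit \<beta> \<sigma>))" for \<sigma>
      using C(3)[of "end_bit \<beta> \<sigma>"]
      by (simp add: end_bit_upd UNIV_bit UNIV_bool add.commute del: sum_of_bool_eq)
    then show ?thesis
      unfolding sum_PiE_insert[OF insert.hyps(2)]
      by (simp only: sum_distrib_left [symmetric] K(3) mult.assoc)
  qed
  with C K show ?case
    by (intro exI[of _ "C * K"] exI[of _ m] exI[of _ t]) auto
qed

section \<open>The cone of constraint functions\<close>

text \<open>The perfect matching of \<open>{1, 2, 3, 4}\<close> that joins 1 to \<open>k\<close>; the other two indices sum
  to \<open>9 - k\<close>.\<close>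

definition partner :: "nat \<Rightarrow> nat \<Rightarrow> nat" where
  "partner k i = (if i = 1 then k else if i = k then 1 else 9 - k - i)"

text \<open>The first component of \<open>j\<close> is the partner of 1, the second the sign common
  to both pairs. The six elements of \<open>pairings\<close> give the extreme rays of the
  cone.\<close>

definition pairing :: "nat \<times> bit \<Rightarrow> (nat \<Rightarrow> bit) \<Rightarrow> bool" where
  "pairing j x \<longleftrightarrow> (\<forall>i\<in>{1..4}. x i + x (partner (fst j) i) = snd j)"

abbreviation pairings :: "(nat \<times> bit) set" where
  "pairings \<equiv> {2, 3, 4} \<times> UNIV"

lemma atLeastAtMost_1_4: "{1..4::nat} = {1, 2, 3, 4}"
  by auto

lemma partner:
  assumes "k \<in> {2, 3, 4}" "i \<in> {1..4}"
  shows "partner k i \<in> {1..4}" "partner k i \<noteq> i" "partner k (partner k i) = i"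
  using assms unfolding atLeastAtMost_1_4 by (elim insertE emptyE; simp add: partner_def)+

text \<open>Both pairs have the same sum \<open>s\<close>, and \<open>s + s = 0\<close> in
  \<open>bit\<close>. This is the local parity condition.\<close>

lemma pairing_sum:
  assumes "k \<in> {2, 3, 4}" "pairing (k, s) x"
  shows "(\<Sum>i\<in>{1..4}. x i) = 0"
proof -
  \<comment> \<open>The three sums are the orders in which the inputs 1 to 4 appear for the
    matchings 12|34, 13|24 and 14|23.\<close>
  have two_pairs: "u + (v + (w + z)) = 0" "u + (w + (v + z)) = 0" "u + (w + (z + v)) = 0"
    if "u + v = s" "w + z = s" for u v w z
    using that by (cases u; cases v; cases w; cases z; simp)+
  have *: "x 1 + x (partner k 1) = s" "x 2 + x (partner k 2) = s" "x 3 + x (partner k 3) = s"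
    using assms(2) unfolding pairing_def atLeastAtMost_1_4 ball_simps fst_conv snd_conv by blast+
  have sum_eq: "(\<Sum>i\<in>{1..4}. x i) = x 1 + (x 2 + (x 3 + x 4))"
    unfolding atLeastAtMost_1_4 by simp
  from assms(1) consider "k = 2" | "k = 3" | "k = 4" by blast
  then show ?thesis
  proof cases
    case 1
    then have "partner k 1 = 2" "partner k 3 = 4" by (simp_all add: partner_def)
    with * have "x 1 + x 2 = s" "x 3 + x 4 = s" by (simp_all only:)
    then show ?thesis unfolding sum_eq by (rule two_pairs)
  next
    case 2
    then have "partner k 1 = 3" "partner k 2 = 4" by (simp_all add: partner_def)
    with * have "x 1 + x 3 = s" "x 2 + x 4 = s" by (simp_all only:)
    then show ?thesis unfolding sum_eq by (rule two_pairs)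
  next
    case 3
    then have "partner k 1 = 4" "partner k 2 = 3" by (simp_all add: partner_def)
    with * have "x 1 + x 4 = s" "x 2 + x 3 = s" by (simp_all only:)
    then show ?thesis unfolding sum_eq by (rule two_pairs)
  qed
qed

text \<open>Scaled to sum 2, the tuples in the closure form the hypersimplex with vertices
  \<open>e\<^sub>i + e\<^sub>j\<close>. The differences of opposite weights are forced; the slack is
  distributed over one opposite pair.\<close>

lemma eight_vertex_eq_pairings:
  assumes "p \<in> F_gt_closure"
  shows "\<exists>w. (\<forall>j. w j \<ge> 0) \<and> (\<forall>x. eight_vertex p (x 1) (x 2) (x 3) (x 4)
    = (\<Sum>j\<in>pairings. w j * of_bool (pairing j x)))"
proof -
  obtain a b c d where p: "p = (a, b, c, d)" by (cases p)
  \<comment> \<open>These are the forced differences \<open>w (2, 0) - w (2, 1)\<close>,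
    \<open>w (3, 1) - w (3, 0)\<close> and \<open>w (4, 1) - w (4, 0)\<close>. The six weights must
    sum to \<open>(a + b + c + d) / 2\<close>.\<close>
  define X Y Z where "X = (a + d - b - c) / 2" and "Y = (a + b - c - d) / 2"
    and "Z = (a + c - b - d) / 2"
  define r where "r = ((a + b + c + d) / 2 - \<bar>X\<bar> - \<bar>Y\<bar> - \<bar>Z\<bar>) / 2"
  \<comment> \<open>Resolving the three absolute values by their eight sign choices gives exactly
    the eight inequalities that define \<open>F_gt_closure\<close>.\<close>
  have r: "r \<ge> 0"
    using assms by (auto simp: p F_gt_closure_def r_def X_def Y_def Z_def abs_if field_simps)
  define w where "w = (\<lambda>(k :: nat, s :: bit).
      if k = 2 then (if s = 0 then max 0 X else max 0 (- X)) + r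
      else if k = 3 then (if s = 0 then max 0 (- Y) else max 0 Y)
      else (if s = 0 then max 0 (- Z) else max 0 Z))"
  have "w j \<ge> 0" for j using r by (auto simp: w_def split: prod.splits)
  \<comment> \<open>Each even input satisfies three of the six pairings, one for each
    \<open>k\<close>; for instance 0011 has sign 0 for 12|34 and sign 1 for the other two
    matchings.\<close>
  moreover have
    "a = w (2, 0) + w (3, 1) + w (4, 1)" "b = w (2, 1) + w (3, 1) + w (4, 0)"
    "c = w (2, 1) + w (3, 0) + w (4, 1)" "d = w (2, 0) + w (3, 0) + w (4, 0)"
    by (auto simp: w_def r_def max_def abs_if X_def Y_def Z_def field_simps)
  then have "eight_vertex p (x 1) (x 2) (x 3) (x 4)
    = (\<Sum>j\<in>pairings. w j * of_bool (pairing j x))" for x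
    unfolding p sum.cartesian_product [symmetric] UNIV_bit pairing_def atLeastAtMost_1_4
    by (cases "x 1"; cases "x 2"; cases "x 3"; cases "x 4")
       (simp_all add: eight_vertex_def partner_def)
  ultimately show ?thesis by blast
qed

section \<open>Closure properties and generators of the cone\<close>

definition constraint_cone :: "constraint set" where
  "constraint_cone = eight_vertex ` F_gt_closure"

lemma constraint_cone_zero: "(\<lambda>_ _ _ _. 0) \<in> constraint_cone"
  unfolding constraint_cone_def
  by (rule image_eqI[of _ _ "(0, 0, 0, 0)"])
     (auto simp: eight_vertex_def F_gt_closure_def fun_eq_iff)

lemma constraint_cone_add:
  assumes "f \<in> constraint_cone" "g \<in> constraint_cone"
  shows "(\<lambda>x1 x2 x3 x4. f x1 x2 x3 x4 + g x1 x2 x3 x4) \<in> constraint_cone"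
proof -
  obtain a b c d a' b' c' d' where
    "(a, b, c, d) \<in> F_gt_closure" "f = eight_vertex (a, b, c, d)"
    "(a', b', c', d') \<in> F_gt_closure" "g = eight_vertex (a', b', c', d')"
    using assms unfolding constraint_cone_def by auto
  then show ?thesis
    unfolding constraint_cone_def
    by (intro image_eqI[of _ _ "(a + a', b + b', c + c', d + d')"])
       (auto simp: eight_vertex_def F_gt_closure_def fun_eq_iff)
qed

lemma constraint_cone_scale:
  assumes "f \<in> constraint_cone" "K \<ge> 0"
  shows "(\<lambda>x1 x2 x3 x4. K * f x1 x2 x3 x4) \<in> constraint_cone"
proof -
  obtain a b c d where
    "(a, b, c, d) \<in> F_gt_closure" "f = eight_vertex (a, b, c, d)"
    using assms unfolding constraint_cone_def by auto
  moreover from this have "(K * a, K * b, K * c, K * d) \<in> F_gt_closure"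
    using assms(2) mult_left_mono[of _ _ K]
    by (auto simp: F_gt_closure_def distrib_left [symmetric])
  ultimately show ?thesis
    unfolding constraint_cone_def
    by (intro image_eqI[of _ _ "(K * a, K * b, K * c, K * d)"])
       (auto simp: eight_vertex_def fun_eq_iff)
qed

lemma constraint_cone_sum:
  assumes "finite A" "\<And>c. c \<in> A \<Longrightarrow> f c \<in> constraint_cone"
  shows "(\<lambda>x1 x2 x3 x4. \<Sum>c\<in>A. f c x1 x2 x3 x4) \<in> constraint_cone"
  using assms
  by (induction A rule: finite_induct) (simp_all add: constraint_cone_zero constraint_cone_add)

text \<open>Each function has a parameter tuple with two entries 1 and two entries 0, read off by
  testing the equations at 0011, 0110, 0101 and 0000.\<close>

lemma two_pairs_in_constraint_cone:
  "(\<lambda>x1 x2 x3 x4. of_bool (x1 + x2 = s \<and> x3 + x4 = s)) \<in> constraint_cone"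
  "(\<lambda>x1 x2 x3 x4. of_bool (x1 + x3 = s \<and> x2 + x4 = s)) \<in> constraint_cone"
  "(\<lambda>x1 x2 x3 x4. of_bool (x1 + x4 = s \<and> x2 + x3 = s)) \<in> constraint_cone"
proof -
  have C: "f \<in> constraint_cone"
    if "(a, b, c, d) \<in> F_gt_closure"
      "\<And>x1 x2 x3 x4. f x1 x2 x3 x4 = eight_vertex (a, b, c, d) x1 x2 x3 x4" for a b c d f
    using that unfolding constraint_cone_def by (intro image_eqI[of _ _ "(a, b, c, d)"]) (auto simp: fun_eq_iff)
  note defs = F_gt_closure_def eight_vertex_def
  show "(\<lambda>x1 x2 x3 x4. of_bool (x1 + x2 = s \<and> x3 + x4 = s)) \<in> constraint_cone"
    by (rule C[of "of_bool (s = 0)" "of_bool (s = 1)" "of_bool (s = 1)" "of_bool (s = 0)"],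
        simp add: defs, case_tac x1; case_tac x2; case_tac x3; case_tac x4; cases s; simp add: defs)
  show "(\<lambda>x1 x2 x3 x4. of_bool (x1 + x3 = s \<and> x2 + x4 = s)) \<in> constraint_cone"
    by (rule C[of "of_bool (s = 1)" "of_bool (s = 1)" "of_bool (s = 0)" "of_bool (s = 0)"],
        simp add: defs, case_tac x1; case_tac x2; case_tac x3; case_tac x4; cases s; simp add: defs)
  show "(\<lambda>x1 x2 x3 x4. of_bool (x1 + x4 = s \<and> x2 + x3 = s)) \<in> constraint_cone"
    by (rule C[of "of_bool (s = 1)" "of_bool (s = 0)" "of_bool (s = 1)" "of_bool (s = 0)"],
        simp add: defs, case_tac x1; case_tac x2; case_tac x3; case_tac x4; cases s; simp add: defs)
qed

text \<open>Two pairs with different signs force odd parity, so \<open>even\<close> leaves only \<open>K = 0\<close> for them.\<close>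

lemma matching_fun_in_constraint_cone:
  assumes K: "K \<ge> (0::real)"
    and M: "signed_matching (Dangling ` {1..4}) m t"
    and F: "\<And>x1 x2 x3 x4. f x1 x2 x3 x4 = K * of_bool (satisfies (Dangling ` {1..4}) m t
      (end_bit (\<lambda>i. [x1, x2, x3, x4] ! (i - 1)) \<sigma>))"
    and even: "\<And>x1 x2 x3 x4. f x1 x2 x3 x4 \<noteq> 0 \<Longrightarrow> x1 + x2 + x3 + x4 = 0"
  shows "f \<in> constraint_cone"
proof -
  have D: "Dangling ` {1..4::nat} = {Dangling 1, Dangling 2, Dangling 3, Dangling 4}"
    by (auto simp: atLeastAtMost_1_4)
  have bits: "end_bit (\<lambda>i. [x1, x2, x3, x4] ! (i - 1)) \<sigma> (Dangling 1) = x1"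
    "end_bit (\<lambda>i. [x1, x2, x3, x4] ! (i - 1)) \<sigma> (Dangling 2) = x2"
    "end_bit (\<lambda>i. [x1, x2, x3, x4] ! (i - 1)) \<sigma> (Dangling 3) = x3"
    "end_bit (\<lambda>i. [x1, x2, x3, x4] ! (i - 1)) \<sigma> (Dangling 4) = x4" for x1 x2 x3 x4
    by (simp_all add: end_bit_def)
  from M show ?thesis
  proof (cases rule: signed_matching_four)
    case 1
    let ?s = "t (Dangling 1)" and ?s' = "t (Dangling 3)"
    have m: "m (Dangling 1) = Dangling 2" "m (Dangling 2) = Dangling 1"
      "m (Dangling 3) = Dangling 4" "m (Dangling 4) = Dangling 3"
      "t (Dangling 2) = ?s" "t (Dangling 4) = ?s'"
      using M 1 unfolding signed_matching_def D by auto
    have F': "f = (\<lambda>x1 x2 x3 x4. K * of_bool (x1 + x2 = ?s \<and> x3 + x4 = ?s'))"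
    proof (intro ext)
      fix x1 x2 x3 x4
      show "f x1 x2 x3 x4 = K * of_bool (x1 + x2 = ?s \<and> x3 + x4 = ?s')"
        unfolding F satisfies_def D ball_simps m bits add.commute[of x2 x1] add.commute[of x4 x3]
        by (rule arg_cong[where f = "\<lambda>b. K * of_bool b"]) blast
    qed
    \<comment> \<open>Setting one point of each pair to 0 and the other to the sign of the pair
      gives a satisfying input of parity \<open>?s + ?s'\<close>. The other two cases use the same
      input, permuted.\<close>
    have "f 0 ?s 0 ?s' = K" by (simp add: F')
    then have "K = 0 \<or> ?s + ?s' = 0"
      using even[of 0 ?s 0 ?s'] by (cases "K = 0") (simp_all add: add.commute)
    then have "K = 0 \<or> ?s = ?s'"
      by (cases ?s; cases ?s') simp_all
    then show ?thesis
      using constraint_cone_scale[OF two_pairs_in_constraint_cone(1) K] constraint_cone_zero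
      by (auto simp: F')
  next
    case 2
    let ?s = "t (Dangling 1)" and ?s' = "t (Dangling 2)"
    have m: "m (Dangling 1) = Dangling 3" "m (Dangling 3) = Dangling 1"
      "m (Dangling 2) = Dangling 4" "m (Dangling 4) = Dangling 2"
      "t (Dangling 3) = ?s" "t (Dangling 4) = ?s'"
      using M 2 unfolding signed_matching_def D by auto
    have F': "f = (\<lambda>x1 x2 x3 x4. K * of_bool (x1 + x3 = ?s \<and> x2 + x4 = ?s'))"
    proof (intro ext)
      fix x1 x2 x3 x4
      show "f x1 x2 x3 x4 = K * of_bool (x1 + x3 = ?s \<and> x2 + x4 = ?s')"
        unfolding F satisfies_def D ball_simps m bits add.commute[of x3 x1] add.commute[of x4 x2]
        by (rule arg_cong[where f = "\<lambda>b. K * of_bool b"]) blast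
    qed
    have "f 0 0 ?s ?s' = K" by (simp add: F')
    then have "K = 0 \<or> ?s + ?s' = 0"
      using even[of 0 0 ?s ?s'] by (cases "K = 0") (simp_all add: add.commute)
    then have "K = 0 \<or> ?s = ?s'"
      by (cases ?s; cases ?s') simp_all
    then show ?thesis
      using constraint_cone_scale[OF two_pairs_in_constraint_cone(2) K] constraint_cone_zero
      by (auto simp: F')
  next
    case 3
    let ?s = "t (Dangling 1)" and ?s' = "t (Dangling 2)"
    have m: "m (Dangling 1) = Dangling 4" "m (Dangling 4) = Dangling 1"
      "m (Dangling 2) = Dangling 3" "m (Dangling 3) = Dangling 2"
      "t (Dangling 4) = ?s" "t (Dangling 3) = ?s'"
      using M 3 unfolding signed_matching_def D by auto
    have F': "f = (\<lambda>x1 x2 x3 x4. K * of_bool (x1 + x4 = ?s \<and> x2 + x3 = ?s'))"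
    proof (intro ext)
      fix x1 x2 x3 x4
      show "f x1 x2 x3 x4 = K * of_bool (x1 + x4 = ?s \<and> x2 + x3 = ?s')"
        unfolding F satisfies_def D ball_simps m bits add.commute[of x4 x1] add.commute[of x3 x2]
        by (rule arg_cong[where f = "\<lambda>b. K * of_bool b"]) blast
    qed
    have "f 0 0 ?s' ?s = K" by (simp add: F')
    then have "K = 0 \<or> ?s + ?s' = 0"
      using even[of 0 0 ?s' ?s] by (cases "K = 0") (simp_all add: add.commute)
    then have "K = 0 \<or> ?s = ?s'"
      by (cases ?s; cases ?s') simp_all
    then show ?thesis
      using constraint_cone_scale[OF two_pairs_in_constraint_cone(3) K] constraint_cone_zero
      by (auto simp: F')
  qed
qed

section \<open>Constructions\<close>

text \<open>Names the description inside \<open>local_bit\<close>; on a construction it inverts the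
  map from an edge-end to its vertex and label.\<close>

definition port :: "('v, 'e, 'm) construction_scheme \<Rightarrow> 'v \<Rightarrow> nat \<Rightarrow> 'e edge_end" where
  "port \<Gamma> v i = (THE h. h \<in> ends_at \<Gamma> v \<and> end_label \<Gamma> h = i)"

lemma edge_ends_eq: "edge_ends \<Gamma> = ends_of (edges \<Gamma>)"
  by (simp add: edge_ends_def ends_of_def)

lemma local_bit_port: "local_bit \<Gamma> \<beta> \<sigma> v i = end_bit \<beta> \<sigma> (port \<Gamma> v i)"
  by (simp add: local_bit_def port_def)

context
  fixes \<Gamma> :: "('v, 'e, 'm) construction_scheme"
  assumes \<Gamma>: "four_ary_construction \<Gamma>"
begin

section \<open>Edge-ends as vertex-label pairs, and parity\<close>

lemma port_label:
  assumes "h \<in> edge_ends \<Gamma>"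
  shows "port \<Gamma> (end_vertex \<Gamma> h) (end_label \<Gamma> h) = h"
    and "end_vertex \<Gamma> h \<in> verts \<Gamma>" and "end_label \<Gamma> h \<in> {1..4}"
proof -
  show v: "end_vertex \<Gamma> h \<in> verts \<Gamma>" using \<Gamma> assms by (auto simp: four_ary_construction_def)
  then have bij: "bij_betw (end_label \<Gamma>) (ends_at \<Gamma> (end_vertex \<Gamma> h)) {1..4}"
    using \<Gamma> by (auto simp: four_ary_construction_def)
  have h: "h \<in> ends_at \<Gamma> (end_vertex \<Gamma> h)" using assms by (auto simp: ends_at_def)
  show "end_label \<Gamma> h \<in> {1..4}" using bij h by (rule bij_betwE[rule_format])
  show "port \<Gamma> (end_vertex \<Gamma> h) (end_label \<Gamma> h) = h"
    unfolding port_def using bij h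
    by (intro the_equality) (auto simp: bij_betw_def inj_on_def)
qed

lemma port:
  assumes "v \<in> verts \<Gamma>" "i \<in> {1..4}"
  shows "port \<Gamma> v i \<in> edge_ends \<Gamma>" "end_vertex \<Gamma> (port \<Gamma> v i) = v"
    "end_label \<Gamma> (port \<Gamma> v i) = i"
proof -
  have "bij_betw (end_label \<Gamma>) (ends_at \<Gamma> v) {1..4}"
    using \<Gamma> assms by (auto simp: four_ary_construction_def)
  then obtain h where h: "h \<in> ends_at \<Gamma> v" "end_label \<Gamma> h = i"
    using assms unfolding bij_betw_def by (metis imageE)
  then have "port \<Gamma> v i = h" using port_label(1)[of h] by (auto simp: ends_at_def)
  with h show "port \<Gamma> v i \<in> edge_ends \<Gamma>" "end_vertex \<Gamma> (port \<Gamma> v i) = v"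
    "end_label \<Gamma> (port \<Gamma> v i) = i" by (auto simp: ends_at_def)
qed

text \<open>Allows sums over edge-ends to be regrouped by vertices.\<close>

lemma bij_betw_port:
  "bij_betw (\<lambda>(v, i). port \<Gamma> v i) (verts \<Gamma> \<times> {1..4}) (edge_ends \<Gamma>)"
  by (rule bij_betw_byWitness[of _ "\<lambda>h. (end_vertex \<Gamma> h, end_label \<Gamma> h)"])
     (use port port_label in auto)

text \<open>Counting edge-ends by vertices and by edges gives 4|V| = 2|E| + 4, hence |E| + 2 =
  2|V|.\<close>

lemma even_card_edges: "even (card (edges \<Gamma>))"
proof -
  have fin: "finite (edges \<Gamma>)" using \<Gamma> by (auto simp: four_ary_construction_def)
  have "card (edge_ends \<Gamma>) = card (verts \<Gamma>) * 4"
    using bij_betw_same_card[OF bij_betw_port] by (simp add: card_cartesian_product)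
  moreover have "card (edge_ends \<Gamma>) = card (edges \<Gamma>) * 2 + 4"
    using sum_ends_of[OF fin, of "\<lambda>_. 1::nat"] by (simp add: edge_ends_eq)
  ultimately show ?thesis by presburger
qed

text \<open>The sum of all end bits is 0 when grouped by vertices; grouped by edges, every internal edge
  contributes 1.\<close>

lemma dangling_bits_sum:
  assumes "\<And>v. v \<in> verts \<Gamma> \<Longrightarrow> (\<Sum>i\<in>{1..4}. local_bit \<Gamma> \<beta> \<sigma> v i) = 0"
  shows "(\<Sum>i\<in>{1..4}. \<beta> i) = 0"
proof -
  have fin: "finite (edges \<Gamma>)" using \<Gamma> by (auto simp: four_ary_construction_def)
  have "(\<Sum>h\<in>edge_ends \<Gamma>. end_bit \<beta> \<sigma> h)
      = (\<Sum>(v, i)\<in>verts \<Gamma> \<times> {1..4}. local_bit \<Gamma> \<beta> \<sigma> v i)"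
    using sum.reindex_bij_betw[OF bij_betw_port, of "end_bit \<beta> \<sigma>"]
    by (simp add: local_bit_port case_prod_beta)
  also have "\<dots> = 0"
    using assms by (simp add: sum.cartesian_product [symmetric])
  finally have "(\<Sum>h\<in>edge_ends \<Gamma>. end_bit \<beta> \<sigma> h) = 0" .
  moreover have "(\<Sum>e\<in>edges \<Gamma>. end_bit \<beta> \<sigma> (Inner e False) + end_bit \<beta> \<sigma> (Inner e True))
      = (\<Sum>e\<in>edges \<Gamma>. 1)"
    by (rule sum.cong) (auto simp: end_bit_def)
  \<comment> \<open>An even number of ones vanishes in \<open>bit\<close>, so only the dangling bits
    survive.\<close>
  moreover have "(\<Sum>e\<in>edges \<Gamma>. 1 :: bit) = 0"
    using even_card_edges by auto
  ultimately show ?thesis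
    unfolding edge_ends_eq sum_ends_of[OF fin] by (simp add: end_bit_def)
qed

text \<open>The pairings chosen at the vertices combine into one signed matching of all edge-ends.
  Contracting the edges leaves a matching of the dangling ends, and the global parity makes its two
  signs agree unless the function is zero.\<close>

lemma pairing_construction_in_cone:
  assumes c: "c \<in> verts \<Gamma> \<rightarrow>\<^sub>E pairings"
  shows "(\<lambda>x1 x2 x3 x4. \<Sum>\<sigma>\<in>edges \<Gamma> \<rightarrow>\<^sub>E UNIV. of_bool (\<forall>v\<in>verts \<Gamma>.
    pairing (c v) (local_bit \<Gamma> (\<lambda>i. [x1, x2, x3, x4] ! (i - 1)) \<sigma> v))) \<in> constraint_cone"
    (is "?f \<in> _")
proof -
  have fin: "finite (edges \<Gamma>)" using \<Gamma> by (auto simp: four_ary_construction_def)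
  have ck: "fst (c v) \<in> {2, 3, 4}" if "v \<in> verts \<Gamma>" for v
    using c that by (auto simp: PiE_iff mem_Times_iff)
  \<comment> \<open>From \<open>h\<close>, go to the edge-end at the same vertex whose label is
    paired with that of \<open>h\<close>.\<close>
  define n where "n h = port \<Gamma> (end_vertex \<Gamma> h)
      (partner (fst (c (end_vertex \<Gamma> h))) (end_label \<Gamma> h))" for h
  define s where "s h = snd (c (end_vertex \<Gamma> h))" for h
  have M: "signed_matching (ends_of (edges \<Gamma>)) n s"
    unfolding signed_matching_def edge_ends_eq [symmetric]
  proof
    fix h assume h: "h \<in> edge_ends \<Gamma>"
    let ?v = "end_vertex \<Gamma> h" and ?i = "end_label \<Gamma> h"
    let ?j = "partner (fst (c ?v)) ?i"
    note ph = port_label[OF h]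
    note pp = partner[OF ck[OF ph(2)] ph(3)]
    note pn = port[OF ph(2) pp(1)]
    show "n h \<in> edge_ends \<Gamma> \<and> n h \<noteq> h \<and> n (n h) = h \<and> s (n h) = s h"
      using pn pp ph(1) unfolding n_def s_def by metis
  qed
  \<comment> \<open>Both sides are the same system of equations, indexed by vertex and label on the
    left and by edge-end on the right.\<close>
  have iff: "(\<forall>v\<in>verts \<Gamma>. pairing (c v) (local_bit \<Gamma> \<beta> \<sigma> v)) \<longleftrightarrow>
      satisfies (ends_of (edges \<Gamma>)) n s (end_bit \<beta> \<sigma>)" (is "?L \<longleftrightarrow> ?R") for \<beta> \<sigma>
  proof
    assume L: ?L
    show ?R
      unfolding satisfies_def edge_ends_eq [symmetric]
    proof
      fix h assume h: "h \<in> edge_ends \<Gamma>"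
      note ph = port_label[OF h]
      show "end_bit \<beta> \<sigma> h + end_bit \<beta> \<sigma> (n h) = s h"
        using bspec[OF L ph(2)] ph(1,3) unfolding pairing_def local_bit_port n_def s_def by metis
    qed
  next
    assume R: ?R
    show ?L
      unfolding pairing_def local_bit_port
    proof (intro ballI)
      fix v and i :: nat assume vi: "v \<in> verts \<Gamma>" "i \<in> {1..4}"
      note pp = port[OF vi]
      show "end_bit \<beta> \<sigma> (port \<Gamma> v i) + end_bit \<beta> \<sigma> (port \<Gamma> v (partner (fst (c v)) i)) = snd (c v)"
        using R pp unfolding satisfies_def edge_ends_eq [symmetric] n_def s_def by metis
    qed
  qed
  from contract_edges[OF fin M] obtain K t and m :: "'e edge_end \<Rightarrow> 'e edge_end"
    where K: "K \<ge> (0::real)"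
    "signed_matching (Dangling ` {1..4}) m t"
    "\<And>\<beta>. (\<Sum>\<sigma>\<in>edges \<Gamma> \<rightarrow>\<^sub>E UNIV. of_bool (satisfies (ends_of (edges \<Gamma>)) n s (end_bit \<beta> \<sigma>)))
       = K * of_bool (satisfies (Dangling ` {1..4}) m t (end_bit \<beta> (\<lambda>_. undefined)))"
    by blast
  show ?thesis
  proof (rule matching_fun_in_constraint_cone[OF K(1,2)])
    show "?f x1 x2 x3 x4 = K * of_bool (satisfies (Dangling ` {1..4}) m t
      (end_bit (\<lambda>i. [x1, x2, x3, x4] ! (i - 1)) (\<lambda>_. undefined)))" for x1 x2 x3 x4
      unfolding iff by (rule K(3))
    show "x1 + x2 + x3 + x4 = 0" if ne: "?f x1 x2 x3 x4 \<noteq> 0" for x1 x2 x3 x4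
    proof -
      let ?\<beta> = "\<lambda>i. [x1, x2, x3, x4] ! (i - 1)"
      \<comment> \<open>A nonzero sum has a nonzero term, and one orientation that satisfies every
        pairing already determines the parity of the dangling bits.\<close>
      from ne obtain \<sigma> where
        "of_bool (\<forall>v\<in>verts \<Gamma>. pairing (c v) (local_bit \<Gamma> ?\<beta> \<sigma> v)) \<noteq> (0 :: real)"
        by (rule sum.not_neutral_contains_not_neutral)
      then have "\<forall>v\<in>verts \<Gamma>. pairing (c v) (local_bit \<Gamma> ?\<beta> \<sigma> v)" by simp
      then have "(\<Sum>i\<in>{1..4}. local_bit \<Gamma> ?\<beta> \<sigma> v i) = 0" if "v \<in> verts \<Gamma>" for v
        using pairing_sum[OF ck[OF that], of "snd (c v)"] that by simp
      then have "(\<Sum>i\<in>{1..4}. ?\<beta> i) = 0" by (rule dangling_bits_sum)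
      then show ?thesis
        unfolding atLeastAtMost_1_4 by (cases x1; cases x2; cases x3; cases x4) simp_all
    qed
  qed
qed

end

section \<open>Multilinear expansion over the vertices\<close>

lemma prod_of_bool:
  "finite A \<Longrightarrow> (\<Prod>v\<in>A. of_bool (P v)) = (of_bool (\<forall>v\<in>A. P v) :: 'a::comm_semiring_1)"
  by (induction A rule: finite_induct) auto

theorem mainTheorem1:
  fixes \<Gamma> :: "('v, 'e) construction"
  assumes "four_ary_construction \<Gamma>"
    and "\<And>v. v \<in> verts \<Gamma> \<Longrightarrow> \<exists>p \<in> F_gt_closure. vertex_fun \<Gamma> v = eight_vertex p"
  shows "\<exists>p \<in> F_gt_closure. construction_fun \<Gamma> = eight_vertex p"
proof -
  have fin: "finite (verts \<Gamma>)" using assms(1) by (auto simp: four_ary_construction_def)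
  have "\<forall>v\<in>verts \<Gamma>. \<exists>w. (\<forall>j. w j \<ge> 0) \<and> (\<forall>x. vertex_fun \<Gamma> v (x 1) (x 2) (x 3) (x 4)
    = (\<Sum>j\<in>pairings. w j * of_bool (pairing j x)))"
    using assms(2) eight_vertex_eq_pairings by fastforce
  from bchoice[OF this] obtain w where w: "\<And>v j. v \<in> verts \<Gamma> \<Longrightarrow> w v j \<ge> (0::real)"
    "\<And>v x. v \<in> verts \<Gamma> \<Longrightarrow> vertex_fun \<Gamma> v (x 1) (x 2) (x 3) (x 4)
      = (\<Sum>j\<in>pairings. w v j * of_bool (pairing j x))"
    by blast
  let ?C = "verts \<Gamma> \<rightarrow>\<^sub>E pairings"
  let ?g = "\<lambda>c x1 x2 x3 x4. \<Sum>\<sigma>\<in>edges \<Gamma> \<rightarrow>\<^sub>E UNIV. of_bool (\<forall>v\<in>verts \<Gamma>.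
    pairing (c v) (local_bit \<Gamma> (\<lambda>i. [x1, x2, x3, x4] ! (i - 1)) \<sigma> v)) :: real"
  have "construction_fun \<Gamma> x1 x2 x3 x4
      = (\<Sum>c\<in>?C. (\<Prod>v\<in>verts \<Gamma>. w v (c v)) * ?g c x1 x2 x3 x4)" for x1 x2 x3 x4
  proof -
    let ?\<beta> = "\<lambda>i. [x1, x2, x3, x4] ! (i - 1)"
    have "construction_fun \<Gamma> x1 x2 x3 x4 = (\<Sum>\<sigma>\<in>edges \<Gamma> \<rightarrow>\<^sub>E UNIV. \<Prod>v\<in>verts \<Gamma>.
        \<Sum>j\<in>pairings. w v j * of_bool (pairing j (local_bit \<Gamma> ?\<beta> \<sigma> v)))"
      unfolding construction_fun_def Let_def
      by (intro sum.cong prod.cong refl w(2)[of v "local_bit \<Gamma> ?\<beta> \<sigma> v" for v \<sigma>])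
    also have "\<dots> = (\<Sum>\<sigma>\<in>edges \<Gamma> \<rightarrow>\<^sub>E UNIV. \<Sum>c\<in>?C. (\<Prod>v\<in>verts \<Gamma>. w v (c v)) *
        of_bool (\<forall>v\<in>verts \<Gamma>. pairing (c v) (local_bit \<Gamma> ?\<beta> \<sigma> v)))"
    proof (rule sum.cong[OF refl])
      fix \<sigma>
      \<comment> \<open>Expanding the product of sums amounts to choosing one pairing
        \<open>c v\<close> at each vertex.\<close>
      have "(\<Prod>v\<in>verts \<Gamma>. \<Sum>j\<in>pairings. w v j * of_bool (pairing j (local_bit \<Gamma> ?\<beta> \<sigma> v)))
        = (\<Sum>c\<in>?C. \<Prod>v\<in>verts \<Gamma>. w v (c v) * of_bool (pairing (c v) (local_bit \<Gamma> ?\<beta> \<sigma> v)))"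
        using fin by (rule prod_sum_PiE) (simp add: UNIV_bit)
      then show "(\<Prod>v\<in>verts \<Gamma>. \<Sum>j\<in>pairings. w v j * of_bool (pairing j (local_bit \<Gamma> ?\<beta> \<sigma> v)))
        = (\<Sum>c\<in>?C. (\<Prod>v\<in>verts \<Gamma>. w v (c v)) *
            of_bool (\<forall>v\<in>verts \<Gamma>. pairing (c v) (local_bit \<Gamma> ?\<beta> \<sigma> v)))"
        by (simp only: prod.distrib prod_of_bool[OF fin])
    qed
    \<comment> \<open>The weight of a choice does not depend on the orientation, so exchanging the
      sums leaves a nonnegative combination of functions in the cone.\<close>
    also have "\<dots> = (\<Sum>c\<in>?C. (\<Prod>v\<in>verts \<Gamma>. w v (c v)) * ?g c x1 x2 x3 x4)"
      unfolding sum_distrib_left by (rule sum.swap)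
    finally show ?thesis .
  qed
  then have "construction_fun \<Gamma>
      = (\<lambda>x1 x2 x3 x4. \<Sum>c\<in>?C. (\<Prod>v\<in>verts \<Gamma>. w v (c v)) * ?g c x1 x2 x3 x4)"
    by (intro ext)
  also have "\<dots> \<in> constraint_cone"
  proof (rule constraint_cone_sum)
    show "finite ?C" using fin by (intro finite_PiE) (auto simp: UNIV_bit)
    show "(\<lambda>x1 x2 x3 x4. (\<Prod>v\<in>verts \<Gamma>. w v (c v)) * ?g c x1 x2 x3 x4) \<in> constraint_cone"
      if "c \<in> ?C" for c
      by (rule constraint_cone_scale[OF pairing_construction_in_cone[OF assms(1) that]])
         (rule prod_nonneg, rule w(1))
  qed
  finally show ?thesis unfolding constraint_cone_def by auto
qed

end
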